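(* Let $q$ and $b$ be integers such that $q\ge 2$, $q$ divides $b$, and $b/q\ge 2$. Let $\tau:\Sigma_q^\ast\to\{-1,0,\ldots,b-2\}$ be a maximal tree mapping. If there exists a positive number $\epsilon_0$ such that for each $n\ge1$ and each $\delta=\delta_1\delta_2\cdots\delta_n\in\Sigma_q^n$ with $\delta_n\ne0$, $$\mathcal D_{\tau,\delta}\ge\epsilon_0 n,$$ then $\Lambda(\tau)$ is not a spectrum of the Cantor measure $\mu_{q,b}$.
   Context: Cantor measure: $\mu_{q,b}$ is the unique Borel probability measure on $\mathbb R$ with $\mu_{q,b}=\frac1q\sum_{i=0}^{q-1}\mu_{q,b}(f_i^{-1}(\cdot))$, where $f_i(x)=x/b+i/q$, $0\le i\le q-1$. A countable set $\Lambda\subset\mathbb R$ is a spectrum of a probability measure $\mu$ if $\{e^{-2\pi i\lambda x}:\lambda\in\Lambda\}$ is an orthogonal basis of $L^2(\mu)$. Words: $\Sigma_q=\{0,1,\ldots,q-1\}$; $\Sigma_q^n$ is the set of words of length $n$ over $\Sigma_q$; $\Sigma_q^\ast=\bigcup_{1\le n<\infty}\Sigma_q^n$; $\Sigma_q^\infty$ is the set of infinite words. Juxtaposition denotes concatenation; $0^k$ is the word of $k$ zeros and $0^\infty=000\cdots$. For $k\ge1$, $\delta|_k$ is the prefix of length $k$ of $\delta$ if $\delta\in\Sigma_q^\infty$, and the prefix of length $k$ of $\delta0^\infty$ if $\delta\in\Sigma_q^\ast$. Tree mapping: a map $\tau:\Sigma_q^\ast\to\{-1,0,\ldots,b-2\}$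 with (i) $\tau(0^n)=0$ for all $n\ge1$; (ii) $\tau(\delta)\in\delta_n+q\mathbb Z$ for every $\delta=\delta_1\cdots\delta_n\in\Sigma_q^n$, $n\ge1$. It is maximal if (iii) for any $\delta\in\Sigma_q^\ast$ there exists $\delta'\in\Sigma_q^\ast$ such that $\tau((\delta\delta')|_n)=0$ for all sufficiently large $n$. $\Lambda(\tau):=\{\sum_{n=1}^\infty\tau(\delta|_n)b^{n-1}:\ \delta\in\Sigma_q^\ast\text{ such that }\tau(\delta|_m)=0\text{ for all sufficiently large }m\}$. Level difference: for $\delta,\delta'\in\Sigma_q^\ast$ put $A_\delta(\delta')=\{m\ge1:\tau(\delta(\delta'|_m))\ne0\}$ and $B_\delta(\delta')=\{m\ge1:\tau(\delta(\delta'|_m))\notin q\mathbb Z\}$; enumerate $A_\delta(\delta')=\{n_j:j\ge1\}$ in strictly increasing order and put $n_0=0$. Then $$\mathcal D_{\tau,\delta}(\delta')=\#A_\delta(\delta')+\sum_{n_j\in B_\delta(\delta')}(n_j-n_{j-1}-1),$$ (with value $\infty$ if $A_\delta(\delta')$ is infinite), and $\mathcal D_{\tau,\delta}:=\inf\{\mathcal D_{\tau,\delta}(\delta'):\delta'\in\Sigma_q^\ast\}$. *)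

theory Defs
  imports "HOL-Probability.Probability"
begin

section \<open>The Cantor measure\<close>

definition is_cantor_measure :: "int \<Rightarrow> int \<Rightarrow> real measure \<Rightarrow> bool" where
  "is_cantor_measure q b \<mu> \<longleftrightarrow>
     prob_space \<mu> \<and> sets \<mu> = sets borel \<and>
     (\<forall>A\<in>sets borel. measure \<mu> A =
        (1 / of_int q) *
        (\<Sum>i\<in>{0..q - 1}. measure \<mu> ((\<lambda>x. x / of_int b + of_int i / of_int q) -` A)))"

text \<open>The description is justified for \<open>q \<ge> 2\<close> and \<open>b \<ge> 2\<close> by \<open>cantor_measure_ex1\<close> below.\<close>

definition cantor_measure :: "int \<Rightarrow> int \<Rightarrow> real measure" where
  "cantor_measure q b = (THE \<mu>. is_cantor_measure q b \<mu>)"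

definition digit_pmf :: "int \<Rightarrow> int pmf" where
  "digit_pmf q = pmf_of_set {0..q - 1}"

lemma nn_integral_digit_pmf:
  assumes "q \<ge> 1" "\<And>i. f i \<ge> 0"
  shows "(\<integral>\<^sup>+i. ennreal (f i) \<partial>measure_pmf (digit_pmf q)) =
     ennreal ((1 / of_int q) * (\<Sum>i\<in>{0..q - 1}. f i))"
proof -
  have "(\<integral>\<^sup>+i. ennreal (f i) \<partial>measure_pmf (digit_pmf q)) =
      (\<Sum>i\<in>{0..q - 1}. ennreal (f i)) / of_nat (card {0..q - 1})"
    unfolding digit_pmf_def
    by (rule nn_integral_pmf_of_set) (use assms(1) in auto)
  also have "\<dots> = ennreal (\<Sum>i\<in>{0..q - 1}. f i) / ennreal (of_int q)"
    using assms by (simp add: sum_ennreal ennreal_of_nat_eq_real_of_nat)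
  also have "\<dots> = ennreal ((\<Sum>i\<in>{0..q - 1}. f i) / of_int q)"
    using assms by (intro divide_ennreal sum_nonneg) auto
  finally show ?thesis by simp
qed

lemma cantor_measure_exists:
  assumes "q \<ge> 2" "b \<ge> 2"
  shows "\<exists>\<mu>. is_cantor_measure q b \<mu>"
proof -
  define P where "P = measure_pmf (digit_pmf q)"
  interpret P: prob_space P unfolding P_def by (rule measure_pmf.prob_space_axioms)
  interpret S: prob_space "stream_space P" by (rule P.prob_space_stream_space)
  define X :: "int stream \<Rightarrow> real" where
    "X s = (\<Sum>k. of_int (s !! k mod q) / (of_int q * of_int b ^ k))" for s
  have [measurable]: "(\<lambda>s. real_of_int (s !! k mod q)) \<in> borel_measurable (stream_space P)" for k
    by (rule measurable_compose[OF measurable_snth]) (simp add: P_def)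
  have X [measurable]: "X \<in> borel_measurable (stream_space P)"
    unfolding X_def by measurable
  have space: "space (stream_space P) = UNIV"
    by (simp add: space_stream_space P_def)
  have summ: "summable (\<lambda>k. real_of_int (s !! k mod q) / (of_int q * of_int b ^ k))" for s
  proof (rule summable_comparison_test')
    show "summable (\<lambda>k. (1 / real_of_int b) ^ k)"
      using assms by (intro summable_geometric) auto
    fix k :: nat
    have "0 \<le> s !! k mod q" "s !! k mod q < q"
      using assms by auto
    then have "real_of_int (s !! k mod q) \<le> of_int q" "0 \<le> real_of_int (s !! k mod q)"
      by auto
    then show "norm (real_of_int (s !! k mod q) / (of_int q * of_int b ^ k)) \<le> (1 / real_of_int b) ^ k"
      using assms divide_right_mono[of "real_of_int (s !! k mod q)" "of_int q" "of_int q * of_int b ^ k"]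
      by (simp add: power_divide)
  qed
  have X_Stream: "X (i ## s) = X s / of_int b + of_int (i mod q) / of_int q" for i s
  proof -
    have "X (i ## s) = (\<Sum>k. of_int ((i ## s) !! Suc k mod q) / (of_int q * of_int b ^ Suc k))
       + of_int ((i ## s) !! 0 mod q) / (of_int q * of_int b ^ 0)"
      unfolding X_def by (subst suminf_split_head[OF summ[of "i ## s"]]) (rule diff_add_cancel[symmetric])
    also have "(\<Sum>k. of_int ((i ## s) !! Suc k mod q) / (of_int q * of_int b ^ Suc k)) = X s / of_int b"
      unfolding X_def suminf_divide[OF summ[of s], symmetric]
      by (intro arg_cong[where f = suminf] ext) (simp add: ac_simps)
    finally show ?thesis by simp
  qed
  define \<mu> where "\<mu> = distr (stream_space P) borel X"
  interpret M: prob_space \<mu> unfolding \<mu>_def by (rule S.prob_space_distr) (rule X)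
  have sets: "sets \<mu> = sets borel" by (simp add: \<mu>_def)
  have "measure \<mu> A = (1 / of_int q) *
        (\<Sum>i\<in>{0..q - 1}. measure \<mu> ((\<lambda>x. x / of_int b + of_int i / of_int q) -` A))"
    if A [measurable]: "A \<in> sets borel" for A
  proof -
    let ?g = "\<lambda>i x. x / of_int b + of_int (i mod q) / real_of_int q"
    have g [measurable]: "?g i -` A \<in> sets borel" for i
      using measurable_sets_borel[of "?g i" borel A] A by simp
    have XA: "X -` A \<in> sets (stream_space P)"
      using measurable_sets[OF X A] by (simp add: space)
    have "emeasure \<mu> A = emeasure (stream_space P) (X -` A)"
      unfolding \<mu>_def by (simp add: emeasure_distr space)
    also have "\<dots> = (\<integral>\<^sup>+i. emeasure (stream_space P) {s\<in>space (stream_space P). i ## s \<in> X -` A} \<partial>P)"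
      by (rule P.emeasure_stream_space[OF XA])
    also have "\<dots> = (\<integral>\<^sup>+i. emeasure \<mu> (?g i -` A) \<partial>P)"
    proof (rule nn_integral_cong)
      fix i
      have "{s\<in>space (stream_space P). i ## s \<in> X -` A} = X -` (?g i -` A)"
        by (auto simp: space X_Stream)
      then show "emeasure (stream_space P) {s\<in>space (stream_space P). i ## s \<in> X -` A} =
          emeasure \<mu> (?g i -` A)"
        unfolding \<mu>_def by (simp add: emeasure_distr space)
    qed
    also have "\<dots> = (\<integral>\<^sup>+i. ennreal (measure \<mu> (?g i -` A)) \<partial>P)"
      by (simp add: M.emeasure_eq_measure)
    also have "\<dots> = ennreal ((1 / of_int q) * (\<Sum>i\<in>{0..q - 1}. measure \<mu> (?g i -` A)))"
      unfolding P_def using assms by (intro nn_integral_digit_pmf) auto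
    finally have "measure \<mu> A = (1 / of_int q) * (\<Sum>i\<in>{0..q - 1}. measure \<mu> (?g i -` A))"
      using assms by (simp add: M.emeasure_eq_measure sum_nonneg)
    also have "(\<Sum>i\<in>{0..q - 1}. measure \<mu> (?g i -` A)) =
        (\<Sum>i\<in>{0..q - 1}. measure \<mu> ((\<lambda>x. x / of_int b + of_int i / of_int q) -` A))"
      by (intro sum.cong refl) simp
    finally show ?thesis .
  qed
  then show ?thesis
    unfolding is_cantor_measure_def using M.prob_space_axioms sets by blast
qed

lemma is_cantor_measure_real_distribution:
  assumes "is_cantor_measure q b \<mu>"
  shows "real_distribution \<mu>"
  using assms unfolding is_cantor_measure_def real_distribution_def real_distribution_axioms_def
  by auto

lemma is_cantor_measure_char:
  assumes \<mu>: "is_cantor_measure q b \<mu>" and q: "q \<ge> 2" and b: "b \<ge> 2"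
  shows "char \<mu> t =
    (\<integral>i. iexp (t * of_int i / of_int q) \<partial>measure_pmf (digit_pmf q)) * char \<mu> (t / of_int b)"
proof -
  define P where "P = measure_pmf (digit_pmf q)"
  interpret P: prob_space P unfolding P_def by (rule measure_pmf.prob_space_axioms)
  interpret M: real_distribution \<mu> by (rule is_cantor_measure_real_distribution[OF \<mu>])
  interpret PM: pair_prob_space P \<mu> ..
  let ?g = "\<lambda>(i, x). x / of_int b + of_int i / real_of_int q"
  have [measurable]: "real_of_int \<in> borel_measurable P" by (simp add: P_def)
  have g [measurable]: "?g \<in> borel_measurable (P \<Otimes>\<^sub>M \<mu>)"
    by measurable
  have eq: "\<mu> = distr (P \<Otimes>\<^sub>M \<mu>) borel ?g"
  proof (rule measure_eqI)
    fix A assume "A \<in> sets \<mu>"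
    then have A: "A \<in> sets borel" by simp
    have sA: "?g -` A \<inter> space (P \<Otimes>\<^sub>M \<mu>) \<in> sets (P \<Otimes>\<^sub>M \<mu>)"
      by (rule measurable_sets[OF g A])
    have "emeasure (distr (P \<Otimes>\<^sub>M \<mu>) borel ?g) A =
        (\<integral>\<^sup>+i. emeasure \<mu> (Pair i -` (?g -` A \<inter> space (P \<Otimes>\<^sub>M \<mu>))) \<partial>P)"
      using A by (simp add: emeasure_distr M.emeasure_pair_measure_alt[OF sA])
    also have "\<dots> = (\<integral>\<^sup>+i. ennreal (measure \<mu> ((\<lambda>x. x / of_int b + of_int i / of_int q) -` A)) \<partial>P)"
      by (intro nn_integral_cong)
        (auto simp: M.emeasure_eq_measure space_pair_measure P_def intro!: arg_cong[where f = "measure \<mu>"])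
    also have "\<dots> = ennreal ((1 / of_int q) *
        (\<Sum>i\<in>{0..q - 1}. measure \<mu> ((\<lambda>x. x / of_int b + of_int i / of_int q) -` A)))"
      unfolding P_def using q by (intro nn_integral_digit_pmf) auto
    also have "\<dots> = emeasure \<mu> A"
      using \<mu> A unfolding is_cantor_measure_def by (simp add: M.emeasure_eq_measure)
    finally show "emeasure \<mu> A = emeasure (distr (P \<Otimes>\<^sub>M \<mu>) borel ?g) A" by simp
  qed simp
  have int: "integrable (P \<Otimes>\<^sub>M \<mu>) (\<lambda>z. iexp (t * ?g z))"
    by (intro PM.P.integrable_iexp) auto
  have "char \<mu> t = (\<integral>z. iexp (t * ?g z) \<partial>(P \<Otimes>\<^sub>M \<mu>))"
    unfolding char_def by (subst eq, subst integral_distr) auto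
  also have "\<dots> = (\<integral>i. (\<integral>x. iexp (t * ?g (i, x)) \<partial>\<mu>) \<partial>P)"
    by (rule PM.integral_fst'[OF int, symmetric])
  also have "\<dots> = (\<integral>i. iexp (t * of_int i / of_int q) * char \<mu> (t / of_int b) \<partial>P)"
  proof (rule Bochner_Integration.integral_cong[OF refl])
    fix i
    have "t * ?g (i, x) = t * of_int i / of_int q + t / of_int b * x" for x
      by (simp add: distrib_left)
    then have "iexp (t * ?g (i, x)) = iexp (t * of_int i / of_int q) * iexp (t / of_int b * x)" for x
      by (simp only: of_real_add distrib_left exp_add)
    then show "(\<integral>x. iexp (t * ?g (i, x)) \<partial>\<mu>) = iexp (t * of_int i / of_int q) * char \<mu> (t / of_int b)"
      unfolding char_def by simp
  qed
  finally show ?thesis by (simp add: P_def)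
qed

lemma cantor_measure_unique:
  assumes \<mu>: "is_cantor_measure q b \<mu>" and \<nu>: "is_cantor_measure q b \<nu>"
    and q: "q \<ge> 2" and b: "b \<ge> 2"
  shows "\<mu> = \<nu>"
proof (rule Levy_uniqueness)
  interpret M: real_distribution \<mu> by (rule is_cantor_measure_real_distribution[OF \<mu>])
  interpret N: real_distribution \<nu> by (rule is_cantor_measure_real_distribution[OF \<nu>])
  show "real_distribution \<mu>" "real_distribution \<nu>" by unfold_locales
  define d where "d = (\<lambda>t. char \<mu> t - char \<nu> t)"
  let ?m = "\<lambda>t. (\<integral>i. iexp (t * of_int i / of_int q) \<partial>measure_pmf (digit_pmf q))"
  have m: "norm (?m t) \<le> 1" for t
  proof -
    have "norm (?m t) \<le> (\<integral>i. norm (iexp (t * of_int i / of_int q)) \<partial>measure_pmf (digit_pmf q))"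
      by (rule integral_norm_bound)
    then show ?thesis by simp
  qed
  have step: "norm (d t) \<le> norm (d (t / of_int b))" for t
  proof -
    have "d t = ?m t * d (t / of_int b)"
      unfolding d_def is_cantor_measure_char[OF \<mu> q b, of t] is_cantor_measure_char[OF \<nu> q b, of t]
      by (simp add: algebra_simps)
    then show ?thesis
      using mult_right_mono[OF m[of t], of "norm (d (t / of_int b))"] by (simp add: norm_mult)
  qed
  have iter: "norm (d t) \<le> norm (d (t / of_int b ^ n))" for t n
  proof (induction n)
    case (Suc n)
    then show ?case
      using step[of "t / of_int b ^ n"] by (simp add: mult.commute)
  qed simp
  have "d t = 0" for t
  proof -
    have "(\<lambda>n. t * (1 / real_of_int b) ^ n) \<longlonglongrightarrow> t * 0"
      using b by (intro tendsto_intros LIMSEQ_power_zero) auto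
    then have lim: "(\<lambda>n. t / of_int b ^ n) \<longlonglongrightarrow> 0"
      by (simp add: power_divide)
    have "isCont d 0"
      unfolding d_def by (intro continuous_intros M.isCont_char N.isCont_char)
    then have "(\<lambda>n. norm (d (t / of_int b ^ n))) \<longlonglongrightarrow> norm (d 0)"
      using lim by (rule tendsto_norm[OF isCont_tendsto_compose])
    moreover have "d 0 = 0" by (simp add: d_def M.char_zero N.char_zero)
    ultimately have "(\<lambda>n. norm (d (t / of_int b ^ n))) \<longlonglongrightarrow> 0" by simp
    then have "norm (d t) \<le> 0"
      by (rule LIMSEQ_le_const) (use iter in auto)
    then show ?thesis by simp
  qed
  then show "char \<mu> = char \<nu>" by (auto simp: d_def)
qed

lemma cantor_measure_ex1:
  assumes "q \<ge> 2" "b \<ge> 2"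
  shows "\<exists>!\<mu>. is_cantor_measure q b \<mu>"
  using cantor_measure_exists[OF assms] cantor_measure_unique[OF _ _ assms] by blast

lemma is_cantor_measure_cantor_measure:
  assumes "q \<ge> 2" "b \<ge> 2"
  shows "is_cantor_measure q b (cantor_measure q b)"
  unfolding cantor_measure_def by (rule theI'[OF cantor_measure_ex1[OF assms]])


section \<open>Spectra\<close>

definition exponential :: "real \<Rightarrow> real \<Rightarrow> complex" where
  "exponential \<xi> x = exp (- 2 * of_real pi * \<i> * of_real \<xi> * of_real x)"

definition square_integrable :: "real measure \<Rightarrow> (real \<Rightarrow> complex) \<Rightarrow> bool" where
  "square_integrable \<mu> f \<longleftrightarrow> f \<in> borel_measurable \<mu> \<and> integrable \<mu> (\<lambda>x. (cmod (f x))\<^sup>2)"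

text \<open>
  The library has no Hilbert space of complex square-integrable functions, so that the
  exponentials form an orthogonal basis is spelled out: they are pairwise orthogonal, and
  their finite linear combinations are dense in the \<open>L\<^sup>2\<close> norm.
\<close>

definition is_spectrum :: "real measure \<Rightarrow> real set \<Rightarrow> bool" where
  "is_spectrum \<mu> \<Lambda> \<longleftrightarrow>
     countable \<Lambda> \<and>
     (\<forall>\<xi>\<in>\<Lambda>. \<forall>\<eta>\<in>\<Lambda>. \<xi> \<noteq> \<eta> \<longrightarrow>
        (\<integral>x. exponential \<xi> x * cnj (exponential \<eta> x) \<partial>\<mu>) = 0) \<and>
     (\<forall>f. square_integrable \<mu> f \<longrightarrow>
        (\<forall>\<epsilon>>0. \<exists>F c. finite F \<and> F \<subseteq> \<Lambda> \<and>
           sqrt (\<integral>x. (cmod (f x - (\<Sum>\<xi>\<in>F. c \<xi> * exponential \<xi> x)))\<^sup>2 \<partial>\<mu>) < \<epsilon>))"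


section \<open>Words and tree mappings\<close>

text \<open>
  Words over \<open>{0, \<dots>, q - 1}\<close> are integer lists; the letter \<open>\<delta>\<^sub>k\<close> is \<open>\<delta> ! (k - 1)\<close>.
\<close>

definition words_of_length :: "int \<Rightarrow> nat \<Rightarrow> int list set" where
  "words_of_length q n = {\<delta>. length \<delta> = n \<and> set \<delta> \<subseteq> {0..q - 1}}"

definition words :: "int \<Rightarrow> int list set" where
  "words q = (\<Union>n\<in>{1..}. words_of_length q n)"

definition prefix_pad :: "int list \<Rightarrow> nat \<Rightarrow> int list" where
  "prefix_pad \<delta> k = take k (\<delta> @ replicate k 0)"

text \<open>
  Tree mappings are total functions on lists; only their values on \<open>words q\<close> matter.
\<close>

definition tree_mapping :: "int \<Rightarrow> int \<Rightarrow> (int list \<Rightarrow> int) \<Rightarrow> bool" where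
  "tree_mapping q b \<tau> \<longleftrightarrow>
     (\<forall>\<delta>\<in>words q. \<tau> \<delta> \<in> {-1..b - 2}) \<and>
     (\<forall>n\<ge>1. \<tau> (replicate n 0) = 0) \<and>
     (\<forall>n\<ge>1. \<forall>\<delta>\<in>words_of_length q n. \<exists>k. \<tau> \<delta> = \<delta> ! (n - 1) + q * k)"

definition maximal_tree_mapping :: "int \<Rightarrow> int \<Rightarrow> (int list \<Rightarrow> int) \<Rightarrow> bool" where
  "maximal_tree_mapping q b \<tau> \<longleftrightarrow>
     tree_mapping q b \<tau> \<and>
     (\<forall>\<delta>\<in>words q. \<exists>\<delta>'\<in>words q.
        eventually (\<lambda>n. \<tau> (prefix_pad (\<delta> @ \<delta>') n) = 0) sequentially)"

text \<open>The summation index is shifted by one, and only finitely many terms are nonzero.\<close>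

definition tree_spectrum :: "int \<Rightarrow> int \<Rightarrow> (int list \<Rightarrow> int) \<Rightarrow> real set" where
  "tree_spectrum q b \<tau> =
     {(\<Sum>n. of_int (\<tau> (prefix_pad \<delta> (Suc n))) * of_int b ^ n) | \<delta>.
        \<delta> \<in> words q \<and> eventually (\<lambda>m. \<tau> (prefix_pad \<delta> m) = 0) sequentially}"


section \<open>Level differences\<close>

definition level_A :: "(int list \<Rightarrow> int) \<Rightarrow> int list \<Rightarrow> int list \<Rightarrow> nat set" where
  "level_A \<tau> \<delta> \<delta>' = {m. m \<ge> 1 \<and> \<tau> (\<delta> @ prefix_pad \<delta>' m) \<noteq> 0}"

definition level_B :: "int \<Rightarrow> (int list \<Rightarrow> int) \<Rightarrow> int list \<Rightarrow> int list \<Rightarrow> nat set" where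
  "level_B q \<tau> \<delta> \<delta>' = {m. m \<ge> 1 \<and> \<tau> (\<delta> @ prefix_pad \<delta>' m) \<notin> {q * k | k. True}}"

text \<open>
  In the list \<open>ns\<close> below, \<open>ns ! 0 = 0\<close> and \<open>ns ! j\<close> is the \<open>j\<close>-th smallest element of
  \<open>level_A\<close>, so the truncated subtraction never truncates.
\<close>

definition level_diff :: "int \<Rightarrow> (int list \<Rightarrow> int) \<Rightarrow> int list \<Rightarrow> int list \<Rightarrow> enat" where
  "level_diff q \<tau> \<delta> \<delta>' =
     (let A = level_A \<tau> \<delta> \<delta>'; B = level_B q \<tau> \<delta> \<delta>'; ns = 0 # sorted_list_of_set A in
      if finite A
      then enat (card A + (\<Sum>j | 1 \<le> j \<and> j \<le> card A \<and> ns ! j \<in> B. ns ! j - ns ! (j - 1) - 1))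
      else \<infinity>)"

definition min_level_diff :: "int \<Rightarrow> (int list \<Rightarrow> int) \<Rightarrow> int list \<Rightarrow> enat" where
  "min_level_diff q \<tau> \<delta> = (INF \<delta>'\<in>words q. level_diff q \<tau> \<delta> \<delta>')"

end

theory Submission
  imports Defs "HOL-Library.Real_Mod"
begin

text \<open>
  Fix \<open>x = 1/2\<close> and let \<open>Q\<^sub>n\<close> be the sum of \<open>|\<mu>^(x + \<lambda>)|\<^sup>2\<close> over the frequencies \<open>\<lambda>\<close> that come from
  words of length \<open>n\<close>. The weights \<open>w(\<delta>) = |\<mu>\<^sub>n^(x + \<lambda>(\<delta>))|\<^sup>2\<close>, where \<open>\<mu>\<^sub>n\<close> is the \<open>n\<close>-th discrete
  approximation of \<open>\<mu>\<close>, sum to 1 over the words of length \<open>n\<close>, so \<open>Q\<^sub>n\<close> is the average of the remaining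
  factor \<open>t(\<delta>) \<le> 1\<close>. Passing to level \<open>n + 1\<close>, the children \<open>\<delta>0\<close> reproduce \<open>Q\<^sub>n\<close>. The other children of
  \<open>\<delta>\<close> carry total weight at most \<open>w(\<delta>)(1 - t(\<delta>))\<close>, and the lower bound on the level difference at the
  continuation \<open>000\<dots>\<close> says that their frequencies have at least \<open>\<epsilon>\<^sub>0(n + 1)\<close> nonzero higher digits.
  Each of these contributes a factor bounded by some \<open>c < 1\<close>, so with \<open>\<rho> = c powr \<epsilon>\<^sub>0\<close> one has
  \<open>1 - Q\<^sub>n\<^sub>+\<^sub>1 \<ge> (1 - \<rho>\<^sup>n\<^sup>+\<^sup>1)(1 - Q\<^sub>n)\<close>. Hence \<open>1 - Q\<^sub>n\<close> stays away from 0, and by Bessel's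
  inequality the exponential with frequency \<open>-1/2\<close> is not in the closed span.
\<close>

section \<open>The mask of consecutive digits\<close>

text \<open>Squared modulus of the Fourier transform of the uniform measure on
  \<open>{0, 1/n, ..., (n-1)/n}\<close>. For \<open>n = q\<close> these points are the translation
  parts of the maps \<open>f_i\<close>.\<close>

definition mask :: "nat \<Rightarrow> real \<Rightarrow> real" where
  "mask n x = (cmod ((\<Sum>k<n. cis (2 * pi * x / real n) ^ k) / of_nat n))\<^sup>2"

lemma mask_nonneg [simp]: "mask n x \<ge> 0"
  by (simp add: mask_def)

lemma mask_le_1: "mask n x \<le> 1"
proof -
  have "cmod (\<Sum>k<n. cis (2 * pi * x / real n) ^ k) \<le> (\<Sum>k<n. 1)"
    by (rule order_trans[OF norm_sum]) (simp add: norm_power)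
  then have "cmod ((\<Sum>k<n. cis (2 * pi * x / real n) ^ k) / of_nat n) \<le> 1"
    by (cases "n = 0") (simp_all add: norm_divide)
  then show ?thesis
    by (simp add: mask_def power_le_one)
qed

lemma mask_periodic: "mask n (x + of_int (int n * k)) = mask n x"
proof (cases "n = 0")
  case False
  have "2 * pi * (x + of_int (int n * k)) / real n = 2 * pi * x / real n + 2 * pi * of_int k"
    using False by (simp add: field_simps)
  then show ?thesis
    by (simp add: mask_def flip: cis_mult)
qed (simp add: mask_def)

text \<open>Orthogonality of the characters of the cyclic group of order \<open>n\<close>: each
  product is a power of one \<open>n\<close>-th root of unity \<open>w\<close>, and for
  \<open>k \<noteq> l\<close> the geometric sum vanishes.\<close>

lemma sum_character_roots_unity:
  assumes "k < n" "l < n"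
  shows "(\<Sum>i<n. (cis (2 * pi * real i / real n) ^ k) * cnj (cis (2 * pi * real i / real n) ^ l)) =
    (if k = l then of_nat n else 0)"
proof -
  define w where "w = cis (2 * pi * (real k - real l) / real n)"
  have n: "n > 0" using assms by simp
  have eq: "(cis (2 * pi * real i / real n) ^ k) * cnj (cis (2 * pi * real i / real n) ^ l) = w ^ i" for i
    unfolding w_def Complex.DeMoivre complex_cnj_power cis_cnj cis_mult
    by (rule arg_cong[where f = cis]) (use n in \<open>simp add: field_simps\<close>)
  show ?thesis
  proof (cases "k = l")
    case True
    then show ?thesis unfolding eq by (simp add: w_def)
  next
    case False
    \<comment> \<open>Otherwise \<open>n\<close> would divide \<open>k - l\<close>, which is nonzero
      and of modulus below \<open>n\<close>.\<close>
    have "w \<noteq> 1"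
    proof
      assume "w = 1"
      then obtain m :: int where "2 * pi * (real k - real l) / real n = of_int m * (2 * pi)"
        unfolding w_def cis_eq_1_iff by blast
      then have "(2 * pi) * (real k - real l) = (2 * pi) * (of_int m * real n)"
        using n by (simp add: field_simps)
      then have "real k - real l = of_int m * real n"
        by (subst (asm) mult_left_cancel) simp_all
      then have "of_int (int k - int l) = real_of_int (m * int n)"
        by simp
      then have m: "int k - int l = m * int n"
        by (simp only: of_int_eq_iff)
      have "\<bar>m\<bar> * int n = \<bar>int k - int l\<bar>"
        by (simp add: m abs_mult)
      also have "\<dots> < 1 * int n"
        using assms by auto
      finally have "\<bar>m\<bar> * int n < 1 * int n" .
      then have "\<bar>m\<bar> < 1"
        by (rule mult_right_less_imp_less) simp
      then have "m = 0" by simp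
      with m False show False by simp
    qed
    moreover have "w ^ n = cis (2 * pi * of_int (int k - int l))"
      unfolding w_def Complex.DeMoivre
      by (rule arg_cong[where f = cis]) (use n in \<open>simp add: field_simps\<close>)
    then have "w ^ n = 1" by simp
    ultimately show ?thesis
      unfolding eq using False by (simp add: geometric_sum)
  qed
qed

text \<open>Expanding the square and summing over \<open>i\<close> leaves the \<open>n\<close>
  diagonal terms, each equal to \<open>n\<close>. By periodicity only residues modulo
  \<open>n\<close> matter, which matches the freedom of a tree mapping in choosing digits.\<close>

lemma mask_sum:
  assumes "n > 0" "\<And>i. i < n \<Longrightarrow> \<exists>k. a i = int i + int n * k"
  shows "(\<Sum>i<n. mask n (x + of_int (a i))) = 1"
proof -
  define z where "z = cis (2 * pi * x / real n)"
  define r where "r i = cis (2 * pi * real i / real n)" for i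
  have mask: "complex_of_real (mask n (x + of_int (a i))) =
      (\<Sum>k<n. \<Sum>l<n. z ^ k * cnj (z ^ l) * (r i ^ k * cnj (r i ^ l))) / (of_nat n)\<^sup>2"
    if i: "i < n" for i
  proof -
    obtain k where k: "a i = int i + int n * k"
      using assms(2)[OF i] by blast
    have cis: "cis (2 * pi * (x + real i) / real n) = z * r i"
      unfolding z_def r_def cis_mult
      by (rule arg_cong[where f = cis]) (simp add: field_simps add_divide_distrib)
    have "mask n (x + of_int (a i)) = mask n (x + real i)"
      using mask_periodic[of n "x + real i" k] by (simp add: k add.assoc)
    also have "complex_of_real \<dots> = (\<Sum>k<n. (z * r i) ^ k) * cnj (\<Sum>l<n. (z * r i) ^ l) / (of_nat n)\<^sup>2"
      unfolding mask_def complex_norm_square cis by (simp add: power2_eq_square)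
    also have "(\<Sum>k<n. (z * r i) ^ k) * cnj (\<Sum>l<n. (z * r i) ^ l) =
        (\<Sum>k<n. \<Sum>l<n. z ^ k * cnj (z ^ l) * (r i ^ k * cnj (r i ^ l)))"
      unfolding cnj_sum sum_product by (simp add: power_mult_distrib ac_simps)
    finally show ?thesis .
  qed
  have "complex_of_real (\<Sum>i<n. mask n (x + of_int (a i))) =
      (\<Sum>i<n. \<Sum>k<n. \<Sum>l<n. z ^ k * cnj (z ^ l) * (r i ^ k * cnj (r i ^ l))) / (of_nat n)\<^sup>2"
    by (simp add: mask sum_divide_distrib)
  also have "(\<Sum>i<n. \<Sum>k<n. \<Sum>l<n. z ^ k * cnj (z ^ l) * (r i ^ k * cnj (r i ^ l))) =
      (\<Sum>k<n. \<Sum>i<n. \<Sum>l<n. z ^ k * cnj (z ^ l) * (r i ^ k * cnj (r i ^ l)))"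
    by (rule sum.swap)
  also have "\<dots> = (\<Sum>k<n. \<Sum>l<n. \<Sum>i<n. z ^ k * cnj (z ^ l) * (r i ^ k * cnj (r i ^ l)))"
    by (rule sum.cong[OF refl], rule sum.swap)
  also have "\<dots> = (\<Sum>k<n. \<Sum>l<n. z ^ k * cnj (z ^ l) * (if k = l then of_nat n else 0))"
    unfolding sum_distrib_left[symmetric] r_def
    by (intro sum.cong refl) (simp only: sum_character_roots_unity lessThan_iff)
  also have "\<dots> = (\<Sum>k<n. z ^ k * cnj (z ^ k) * of_nat n)"
    by (intro sum.cong refl) (simp add: if_distrib[of "\<lambda>u. _ * u"] cong: if_cong)
  also have "\<dots> = (\<Sum>k<n. of_nat n)"
    by (intro sum.cong refl)
      (simp add: z_def cis_cnj cis_mult flip: power_mult_distrib)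
  also have "\<dots> / (of_nat n)\<^sup>2 = complex_of_real 1"
    using assms(1) by (simp add: power2_eq_square)
  finally show ?thesis
    by (simp only: of_real_eq_iff)
qed

text \<open>The first two terms of the geometric sum never point in the same direction on this
  range, so together they have modulus at most some \<open>s < 2\<close>; the other
  \<open>n - 2\<close> terms are bounded by 1 each.\<close>

lemma mask_gap:
  assumes n: "n \<ge> 2" and \<eta>: "\<eta> > 0"
  shows "\<exists>c. 0 < c \<and> c < 1 \<and> (\<forall>x\<in>{\<eta>..1 - \<eta>}. mask n x \<le> c)"
proof (cases "\<eta> \<le> 1 - \<eta>")
  case True
  \<comment> \<open>The modulus of \<open>1 + cis t\<close> at the smallest angle that occurs; since
    cosine decreases on \<open>[0, pi]\<close>, larger angles give smaller values.\<close>
  define s where "s = sqrt (2 + 2 * cos (2 * pi * \<eta> / real n))"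
  define C where "C = (real n - 2 + s) / real n"
  have ang: "0 \<le> 2 * pi * \<eta> / real n" "2 * pi * \<eta> / real n < pi"
  proof -
    have "2 * \<eta> < real n" using True n \<eta> by linarith
    then show "2 * pi * \<eta> / real n < pi" using n by (simp add: field_simps)
  qed (use \<eta> in auto)
  have cos1: "cos (2 * pi * \<eta> / real n) < cos 0" and cos2: "cos pi < cos (2 * pi * \<eta> / real n)"
    using ang \<eta> n by (intro cos_monotone_0_pi; simp)+
  have s0: "s > 0" unfolding s_def using cos2 by simp
  have "s < sqrt (2 + 2 * 1)" unfolding s_def using cos1 by (intro real_sqrt_less_mono) simp
  then have s2: "s < 2" by simp
  have C: "0 < C" "C < 1" using n s0 s2 by (auto simp: C_def)
  have "mask n x \<le> C\<^sup>2" if x: "x \<in> {\<eta>..1 - \<eta>}" for x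
  proof -
    define t where "t = 2 * pi * x / real n"
    obtain m where m: "n = Suc (Suc m)"
      using n by (metis Suc_le_D numeral_2_eq_2 Suc_le_mono)
    have t: "2 * pi * \<eta> / real n \<le> t" "t \<le> pi"
    proof -
      show "2 * pi * \<eta> / real n \<le> t"
        unfolding t_def using x by (intro divide_right_mono mult_left_mono) auto
      have "2 * x \<le> real n" using x n \<eta> by auto
      then show "t \<le> pi" using n unfolding t_def by (simp add: field_simps)
    qed
    have "(cmod (1 + cis t))\<^sup>2 = (1 + cos t)\<^sup>2 + (sin t)\<^sup>2"
      by (simp add: cmod_power2)
    also have "\<dots> = 2 + 2 * cos t"
      using sin_cos_squared_add[of t] by (simp add: power2_eq_square algebra_simps)
    also have "\<dots> \<le> 2 + 2 * cos (2 * pi * \<eta> / real n)"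
      using t ang by (simp add: cos_monotone_0_pi_le)
    finally have 1: "cmod (1 + cis t) \<le> s"
      unfolding s_def by (rule real_le_rsqrt)
    have "cmod (\<Sum>k<n. cis t ^ k) = cmod ((1 + cis t) + (\<Sum>k<m. cis t ^ Suc (Suc k)))"
      unfolding m sum.lessThan_Suc_shift by (simp add: add.assoc)
    also have "\<dots> \<le> s + (\<Sum>k<m. 1)"
      by (intro norm_triangle_mono 1 order_trans[OF norm_sum])
        (simp_all add: norm_power norm_mult)
    finally have "cmod (\<Sum>k<n. cis t ^ k) / real n \<le> C"
      unfolding C_def using m by (intro divide_right_mono) simp_all
    then show ?thesis
      unfolding mask_def t_def[symmetric] norm_divide by (intro power_mono) auto
  qed
  then show ?thesis
    using C by (intro exI[of _ "C\<^sup>2"]) (auto simp: power_less_one_iff)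
next
  \<comment> \<open>The interval is empty, so any constant between 0 and 1 serves.\<close>
  case False
  then show ?thesis by (intro exI[of _ "1/2"]) auto
qed

text \<open>The digit average in the functional equation of the characteristic function is the
  geometric sum inside \<open>mask\<close>.\<close>

lemma cantor_char_mask:
  assumes \<mu>: "is_cantor_measure q b \<mu>" and q: "q \<ge> 2" and b: "b \<ge> 2"
  shows "(cmod (char \<mu> (2 * pi * x)))\<^sup>2 =
    mask (nat q) x * (cmod (char \<mu> (2 * pi * (x / of_int b))))\<^sup>2"
proof -
  have "(\<integral>i. iexp (2 * pi * x * of_int i / of_int q) \<partial>measure_pmf (digit_pmf q)) =
      (\<Sum>i\<in>{0..q - 1}. cis (2 * pi * x * of_int i / of_int q)) / of_int q"
    unfolding digit_pmf_def cis_conv_exp using q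
    by (subst integral_measure_pmf[of "{0..q - 1}"])
      (auto simp: scaleR_conv_of_real sum_divide_distrib intro!: sum.cong)
  also have "(\<Sum>i\<in>{0..q - 1}. cis (2 * pi * x * of_int i / of_int q)) =
      (\<Sum>k<nat q. cis (2 * pi * x / real (nat q)) ^ k)"
    by (rule sum.reindex_bij_witness[of _ int nat])
      (use q in \<open>auto simp: Complex.DeMoivre mult_ac\<close>)
  finally show ?thesis
    using is_cantor_measure_char[OF \<mu> q b, of "2 * pi * x"] q
    by (simp add: mask_def norm_mult norm_divide power_mult_distrib power_divide)
qed

section \<open>Bessel's inequality and a convergent product\<close>

lemma exponential_mult_cnj:
  "exponential \<xi> x * cnj (exponential \<eta> x) = iexp (2 * pi * (\<eta> - \<xi>) * x)"
  unfolding exponential_def exp_cnj exp_add[symmetric]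
  by (rule arg_cong[where f = exp]) (simp add: algebra_simps)

text \<open>With Fourier coefficients \<open>k \<zeta>\<close>, the squared error is 1 minus the sum
  of \<open>|k \<zeta>|^2\<close> plus the sum of \<open>|c \<zeta> - k \<zeta>|^2\<close>; the last
  sum is dropped.\<close>

lemma exponential_approximation_bound:
  assumes \<mu>: "real_distribution \<mu>" and F: "finite F"
    and orth: "\<And>\<zeta> \<eta>. \<zeta> \<in> F \<Longrightarrow> \<eta> \<in> F \<Longrightarrow> \<zeta> \<noteq> \<eta> \<Longrightarrow>
      (\<integral>x. exponential \<zeta> x * cnj (exponential \<eta> x) \<partial>\<mu>) = 0"
  shows "1 - (\<Sum>\<zeta>\<in>F. (cmod (char \<mu> (2 * pi * (\<zeta> - \<xi>))))\<^sup>2) \<le>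
    (\<integral>x. (cmod (exponential \<xi> x - (\<Sum>\<zeta>\<in>F. c \<zeta> * exponential \<zeta> x)))\<^sup>2 \<partial>\<mu>)"
proof -
  interpret real_distribution \<mu> by (rule \<mu>)
  define E where "E \<zeta> \<eta> x = exponential \<zeta> x * cnj (exponential \<eta> x)" for \<zeta> \<eta> x
  define k where "k \<zeta> = char \<mu> (2 * pi * (\<zeta> - \<xi>))" for \<zeta>
  have E_int [simp]: "integrable \<mu> (E \<zeta> \<eta>)" for \<zeta> \<eta>
    unfolding E_def exponential_mult_cnj by (rule integrable_iexp) auto
  have E_char: "integral\<^sup>L \<mu> (E \<zeta> \<eta>) = char \<mu> (2 * pi * (\<eta> - \<zeta>))" for \<zeta> \<eta>
    unfolding E_def exponential_mult_cnj char_def ..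
  have E_same: "integral\<^sup>L \<mu> (E \<zeta> \<zeta>) = 1" for \<zeta>
    unfolding E_char by (simp add: char_zero)
  have E_cnj: "integral\<^sup>L \<mu> (E \<zeta> \<xi>) = cnj (k \<zeta>)" for \<zeta>
  proof -
    have "E \<zeta> \<xi> = (\<lambda>x. cnj (E \<xi> \<zeta> x))"
      by (simp add: fun_eq_iff E_def)
    then have "integral\<^sup>L \<mu> (E \<zeta> \<xi>) = cnj (integral\<^sup>L \<mu> (E \<xi> \<zeta>))"
      by (simp flip: integral_cnj)
    then show ?thesis by (simp add: E_char k_def)
  qed
  have E_F: "integral\<^sup>L \<mu> (E \<zeta> \<eta>) = (if \<zeta> = \<eta> then 1 else 0)" if "\<zeta> \<in> F" "\<eta> \<in> F" for \<zeta> \<eta>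
    using orth[OF that] E_same by (auto simp: E_def[abs_def])
  have expand: "complex_of_real ((cmod (exponential \<xi> x - (\<Sum>\<zeta>\<in>F. c \<zeta> * exponential \<zeta> x)))\<^sup>2) =
      E \<xi> \<xi> x - (\<Sum>\<zeta>\<in>F. cnj (c \<zeta>) * E \<xi> \<zeta> x) - (\<Sum>\<zeta>\<in>F. c \<zeta> * E \<zeta> \<xi> x)
      + (\<Sum>\<zeta>\<in>F. \<Sum>\<eta>\<in>F. c \<zeta> * cnj (c \<eta>) * E \<zeta> \<eta> x)" for x
    unfolding complex_norm_square complex_cnj_diff cnj_sum left_diff_distrib right_diff_distrib
      sum_product
    by (simp add: sum_distrib_left sum_distrib_right E_def ac_simps)
  have "complex_of_real (\<integral>x. (cmod (exponential \<xi> x - (\<Sum>\<zeta>\<in>F. c \<zeta> * exponential \<zeta> x)))\<^sup>2 \<partial>\<mu>) =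
      (\<integral>x. complex_of_real ((cmod (exponential \<xi> x - (\<Sum>\<zeta>\<in>F. c \<zeta> * exponential \<zeta> x)))\<^sup>2) \<partial>\<mu>)"
    by (rule integral_complex_of_real[symmetric])
  also have "\<dots> = 1 - (\<Sum>\<zeta>\<in>F. cnj (c \<zeta>) * k \<zeta>) - (\<Sum>\<zeta>\<in>F. c \<zeta> * cnj (k \<zeta>))
      + (\<Sum>\<zeta>\<in>F. \<Sum>\<eta>\<in>F. c \<zeta> * cnj (c \<eta>) * integral\<^sup>L \<mu> (E \<zeta> \<eta>))"
    unfolding expand by (simp add: E_same E_cnj) (simp add: E_char k_def)
  also have "(\<Sum>\<zeta>\<in>F. \<Sum>\<eta>\<in>F. c \<zeta> * cnj (c \<eta>) * integral\<^sup>L \<mu> (E \<zeta> \<eta>)) = (\<Sum>\<zeta>\<in>F. c \<zeta> * cnj (c \<zeta>))"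
    using F by (intro sum.cong refl) (simp add: E_F if_distrib[of "\<lambda>u. _ * u"] cong: if_cong)
  \<comment> \<open>Completing the square in each coefficient.\<close>
  also have "1 - (\<Sum>\<zeta>\<in>F. cnj (c \<zeta>) * k \<zeta>) - (\<Sum>\<zeta>\<in>F. c \<zeta> * cnj (k \<zeta>)) + (\<Sum>\<zeta>\<in>F. c \<zeta> * cnj (c \<zeta>)) =
      1 - (\<Sum>\<zeta>\<in>F. k \<zeta> * cnj (k \<zeta>)) + (\<Sum>\<zeta>\<in>F. (c \<zeta> - k \<zeta>) * cnj (c \<zeta> - k \<zeta>))"
    by (simp add: algebra_simps sum.distrib sum_subtractf)
  also have "\<dots> = complex_of_real (1 - (\<Sum>\<zeta>\<in>F. (cmod (k \<zeta>))\<^sup>2) + (\<Sum>\<zeta>\<in>F. (cmod (c \<zeta> - k \<zeta>))\<^sup>2))"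
    by (simp only: of_real_add of_real_diff of_real_sum of_real_1 complex_norm_square)
  finally have "(\<integral>x. (cmod (exponential \<xi> x - (\<Sum>\<zeta>\<in>F. c \<zeta> * exponential \<zeta> x)))\<^sup>2 \<partial>\<mu>) =
      1 - (\<Sum>\<zeta>\<in>F. (cmod (k \<zeta>))\<^sup>2) + (\<Sum>\<zeta>\<in>F. (cmod (c \<zeta> - k \<zeta>))\<^sup>2)"
    by (simp only: of_real_eq_iff)
  then show ?thesis
    by (simp add: k_def sum_nonneg)
qed

lemma square_integrable_exponential:
  assumes "real_distribution \<mu>"
  shows "square_integrable \<mu> (exponential \<xi>)"
proof -
  interpret real_distribution \<mu> by (rule assms)
  have "continuous_on UNIV (exponential \<xi>)"
    unfolding exponential_def[abs_def] by (intro continuous_intros)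
  then have "exponential \<xi> \<in> borel_measurable \<mu>"
    by (simp add: borel_measurable_continuous_onI)
  moreover have "cmod (exponential \<xi> x) = 1" for x
    by (simp add: exponential_def)
  ultimately show ?thesis
    by (simp add: square_integrable_def)
qed

text \<open>The partial products decrease to the infinite product, which is nonzero because the
  geometric series converges and no factor vanishes.\<close>

lemma geometric_product_bounded_below:
  fixes \<rho> :: real
  assumes \<rho>: "0 < \<rho>" "\<rho> < 1"
  shows "\<exists>\<kappa>>0. \<forall>n. \<kappa> \<le> (\<Prod>k<n. 1 - \<rho> ^ Suc k)"
proof -
  have less: "\<rho> ^ Suc k < 1" for k
    using \<rho> by (rule power_Suc_less_one)
  have "summable (\<lambda>k. \<rho> ^ Suc k)"
    using \<rho> by (subst summable_Suc_iff) (auto intro: summable_geometric)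
  then have "abs_convergent_prod (\<lambda>k. 1 - \<rho> ^ Suc k)"
    using \<rho> by (intro summable_imp_abs_convergent_prod) (simp add: abs_mult)
  then have conv: "convergent_prod (\<lambda>k. 1 - \<rho> ^ Suc k)"
    by (rule abs_convergent_prod_imp_convergent_prod)
  define \<kappa> where "\<kappa> = prodinf (\<lambda>k. 1 - \<rho> ^ Suc k)"
  have "(\<lambda>n. \<Prod>k<Suc n. 1 - \<rho> ^ Suc k) \<longlonglongrightarrow> \<kappa>"
    using convergent_prod_LIMSEQ[OF conv] by (simp only: \<kappa>_def lessThan_Suc_atMost)
  then have lim: "(\<lambda>n. \<Prod>k<n. 1 - \<rho> ^ Suc k) \<longlonglongrightarrow> \<kappa>"
    by (rule LIMSEQ_imp_Suc)
  have nonneg: "(\<Prod>k<n. 1 - \<rho> ^ Suc k) \<ge> 0" for n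
    using less by (intro prod_nonneg) (simp add: less_imp_le del: power_Suc)
  have "1 - \<rho> ^ Suc k \<noteq> 0" for k
    using less[of k] by linarith
  then have "\<kappa> \<noteq> 0"
    unfolding \<kappa>_def by (rule prodinf_nonzero[OF conv])
  moreover have "\<kappa> \<ge> 0"
    using nonneg by (intro LIMSEQ_le_const[OF lim]) blast
  moreover have "decseq (\<lambda>n. \<Prod>k<n. 1 - \<rho> ^ Suc k)"
  proof (rule decseq_SucI)
    fix n
    have "(\<Prod>k<n. 1 - \<rho> ^ Suc k) * (1 - \<rho> ^ Suc n) \<le> (\<Prod>k<n. 1 - \<rho> ^ Suc k) * 1"
      using \<rho> by (intro mult_left_mono nonneg) simp
    then show "(\<Prod>k<Suc n. 1 - \<rho> ^ Suc k) \<le> (\<Prod>k<n. 1 - \<rho> ^ Suc k)"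
      by simp
  qed
  then have "\<kappa> \<le> (\<Prod>k<n. 1 - \<rho> ^ Suc k)" for n
    using lim by (rule decseq_ge)
  ultimately show ?thesis by (intro exI[of _ \<kappa>]) auto
qed

section \<open>Frequencies of a tree mapping\<close>

locale cantor_tree =
  fixes q b :: int and \<tau> :: "int list \<Rightarrow> int"
  assumes q: "q \<ge> 2" and q_dvd_b: "q dvd b" and b_div_q: "b div q \<ge> 2"
    and tree: "tree_mapping q b \<tau>"
begin

abbreviation B :: real where "B \<equiv> of_int b"

abbreviation W :: "nat \<Rightarrow> int list set" where "W \<equiv> words_of_length q"

text \<open>Indices start at 0, so that this is the coefficient of \<open>b ^ k\<close>; the word is
  read as continued by zeros.\<close>

definition digit :: "int list \<Rightarrow> nat \<Rightarrow> int" where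
  "digit \<delta> k = \<tau> (prefix_pad \<delta> (Suc k))"

definition terminating :: "int list \<Rightarrow> bool" where
  "terminating \<delta> \<longleftrightarrow> eventually (\<lambda>k. digit \<delta> k = 0) sequentially"

definition partial_freq :: "int list \<Rightarrow> nat \<Rightarrow> int" where
  "partial_freq \<delta> n = (\<Sum>k<n. digit \<delta> k * b ^ k)"

text \<open>Meaningful for terminating words only: otherwise the series diverges, so later sums over
  words test \<open>terminating\<close> first.\<close>

definition freq :: "int list \<Rightarrow> real" where
  "freq \<delta> = (\<Sum>k. of_int (digit \<delta> k) * B ^ k)"

text \<open>Squared modulus of the transform of the \<open>n\<close>-th discrete approximation of
  the Cantor measure.\<close>

definition mask_prod :: "nat \<Rightarrow> real \<Rightarrow> real" where
  "mask_prod n x = (\<Prod>j<n. mask (nat q) (x / B ^ j))"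

definition power_spec :: "real \<Rightarrow> real" where
  "power_spec x = (cmod (char (cantor_measure q b) (2 * pi * x)))\<^sup>2"

lemma b_ge: "b \<ge> 4"
proof -
  have "b = q * (b div q)" using q_dvd_b by simp
  moreover have "2 * 2 \<le> q * (b div q)" using q b_div_q by (intro mult_mono) auto
  ultimately show ?thesis by linarith
qed

lemma cantor: "is_cantor_measure q b (cantor_measure q b)"
  using q b_ge by (intro is_cantor_measure_cantor_measure) auto

lemma real_distribution_cantor: "real_distribution (cantor_measure q b)"
  by (rule is_cantor_measure_real_distribution[OF cantor])

lemma power_spec_nonneg: "power_spec x \<ge> 0"
  by (simp add: power_spec_def)

lemma power_spec_le_1: "power_spec x \<le> 1"
  using real_distribution.cmod_char_le_1[OF real_distribution_cantor, of "2 * pi * x"]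
  by (simp add: power_spec_def power_le_one)

lemma power_spec_step: "power_spec x = mask (nat q) x * power_spec (x / B)"
  using cantor_char_mask[OF cantor] q b_ge by (simp add: power_spec_def)

lemma power_spec_mask_prod: "power_spec x = mask_prod n x * power_spec (x / B ^ n)"
proof (induction n)
  case (Suc n)
  then show ?case
    using power_spec_step[of "x / B ^ n"] by (simp add: mask_prod_def mult.commute mult.left_commute)
qed (simp add: mask_prod_def)

lemma power_spec_le_mask: "power_spec x \<le> mask (nat q) x"
  using mult_left_mono[OF power_spec_le_1 mask_nonneg] by (subst power_spec_step) simp

lemma mask_prod_nonneg: "mask_prod n x \<ge> 0"
  by (simp add: mask_prod_def prod_nonneg)

lemma mask_shift: "mask (nat q) (x + of_int (q * k)) = mask (nat q) x"
  using mask_periodic[of "nat q" x k] q by simp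

lemma mask_shift_dvd: "q dvd m \<Longrightarrow> mask (nat q) (x + of_int m) = mask (nat q) x"
  using mask_shift by (elim dvdE) blast

text \<open>In each factor \<open>j < n\<close> the shift is still a multiple of \<open>b\<close>,
  hence of the period \<open>q\<close>.\<close>

lemma mask_prod_shift: "mask_prod n (x + of_int (b ^ n * m)) = mask_prod n x"
  unfolding mask_prod_def
proof (rule prod.cong[OF refl])
  fix j assume "j \<in> {..<n}"
  then have n: "n = j + Suc (n - Suc j)" by simp
  have "b ^ n = b ^ j * (b * b ^ (n - Suc j))"
    by (subst n, subst power_add) simp
  then have "(x + of_int (b ^ n * m)) / B ^ j = x / B ^ j + of_int (b * (b ^ (n - Suc j) * m))"
    using b_ge by (simp add: add_divide_distrib)
  then show "mask (nat q) ((x + of_int (b ^ n * m)) / B ^ j) = mask (nat q) (x / B ^ j)"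
    using q_dvd_b by (simp only: mask_shift_dvd dvd_mult2)
qed

section \<open>Padded words, digits and frequencies\<close>

lemma prefix_pad_in_W: "\<delta> \<in> W n \<Longrightarrow> prefix_pad \<delta> k \<in> W k"
  using q by (auto simp: words_of_length_def prefix_pad_def dest!: in_set_takeD)

lemma prefix_pad_append_zeros:
  "\<delta> \<in> W n \<Longrightarrow> prefix_pad \<delta> (n + m) = \<delta> @ replicate m 0"
  by (simp add: words_of_length_def prefix_pad_def)

lemma prefix_pad_append: "\<delta> \<in> W n \<Longrightarrow> k \<le> n \<Longrightarrow> prefix_pad (\<delta> @ \<delta>') k = prefix_pad \<delta> k"
  by (simp add: words_of_length_def prefix_pad_def)

lemma prefix_pad_append_zero: "prefix_pad (\<delta> @ replicate m 0) k = prefix_pad \<delta> k"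
  by (simp add: prefix_pad_def take_replicate min_def flip: replicate_add)

lemma digit_range:
  assumes "\<delta> \<in> W n"
  shows "digit \<delta> k \<in> {-1..b - 2}"
proof -
  have "prefix_pad \<delta> (Suc k) \<in> words q"
    using prefix_pad_in_W[OF assms] by (auto simp: words_def)
  then show ?thesis
    using tree unfolding tree_mapping_def digit_def by blast
qed

lemma tree_last_digit:
  assumes "\<delta> \<in> W n" "i \<in> {0..q - 1}"
  shows "\<exists>k. \<tau> (\<delta> @ [i]) = i + q * k"
proof -
  have "\<delta> @ [i] \<in> W (Suc n)" using assms by (auto simp: words_of_length_def)
  moreover have "(\<delta> @ [i]) ! n = i"
    using assms by (simp add: words_of_length_def nth_append)
  ultimately show ?thesis
    using tree unfolding tree_mapping_def by (metis diff_Suc_1 le_add1 plus_1_eq_Suc)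
qed

text \<open>Condition (ii) on tree mappings sees only the last letter, which is 0 here.\<close>

lemma q_dvd_tree_zeros:
  assumes "\<delta> \<in> W n" "m \<ge> 1"
  shows "q dvd \<tau> (\<delta> @ replicate m 0)"
proof -
  have "\<delta> @ replicate (m - 1) 0 \<in> W (n + (m - 1))"
    using assms q by (auto simp: words_of_length_def)
  from tree_last_digit[OF this, of 0] q obtain k where
    "\<tau> ((\<delta> @ replicate (m - 1) 0) @ [0]) = q * k" by auto
  moreover have "(\<delta> @ replicate (m - 1) 0) @ [0] = \<delta> @ replicate m 0"
    using assms(2) by (simp add: replicate_append_same flip: replicate_Suc)
  ultimately show ?thesis by simp
qed

lemma q_dvd_digit:
  assumes "\<delta> \<in> W n" "n \<le> k"
  shows "q dvd digit \<delta> k"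
  using q_dvd_tree_zeros[OF assms(1), of "Suc k - n"]
    prefix_pad_append_zeros[OF assms(1), of "Suc k - n"] assms(2)
  by (simp add: digit_def Suc_diff_le)

lemma terminating_freq:
  assumes "terminating \<delta>"
  obtains K where "n \<le> K" "\<And>k. k \<ge> K \<Longrightarrow> digit \<delta> k = 0" "freq \<delta> = of_int (partial_freq \<delta> K)"
proof -
  obtain K0 where K0: "\<And>k. k \<ge> K0 \<Longrightarrow> digit \<delta> k = 0"
    using assms unfolding terminating_def eventually_sequentially by blast
  have "freq \<delta> = (\<Sum>k<max n K0. of_int (digit \<delta> k) * B ^ k)"
    unfolding freq_def by (rule suminf_finite) (auto simp: K0)
  then have "freq \<delta> = of_int (partial_freq \<delta> (max n K0))"
    by (simp add: partial_freq_def)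
  then show thesis using K0 by (intro that[of "max n K0"]) auto
qed

text \<open>The divisor \<open>d\<close> will be \<open>q\<close> beyond the end of a word, and 1
  where only integrality matters.\<close>

lemma partial_freq_tail:
  assumes "n \<le> K" "\<And>k. n \<le> k \<Longrightarrow> d dvd digit \<delta> k"
  shows "\<exists>m. partial_freq \<delta> K = partial_freq \<delta> n + b ^ n * (d * m)"
proof -
  have "b ^ n * d dvd (\<Sum>k\<in>{n..<K}. digit \<delta> k * b ^ k)"
  proof (rule dvd_sum)
    fix k assume "k \<in> {n..<K}"
    then have "d * b ^ n dvd digit \<delta> k * b ^ k"
      using assms(2) by (intro mult_dvd_mono le_imp_power_dvd) auto
    then show "b ^ n * d dvd digit \<delta> k * b ^ k"
      by (simp add: mult.commute)
  qed
  then obtain m where m: "(\<Sum>k\<in>{n..<K}. digit \<delta> k * b ^ k) = b ^ n * d * m" by (elim dvdE)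
  have "partial_freq \<delta> K = partial_freq \<delta> n + (\<Sum>k\<in>{n..<K}. digit \<delta> k * b ^ k)"
    unfolding partial_freq_def lessThan_atLeast0
    by (rule sum.atLeastLessThan_concat[symmetric]) (use assms(1) in auto)
  with m show ?thesis by (auto simp: mult.assoc)
qed

lemma freq_tail:
  assumes "terminating \<delta>" "\<And>k. n \<le> k \<Longrightarrow> d dvd digit \<delta> k"
  obtains m where "freq \<delta> = of_int (partial_freq \<delta> n + b ^ n * (d * m))"
  using terminating_freq[OF assms(1), of n] partial_freq_tail[OF _ assms(2)] by metis

text \<open>The term \<open>- 1\<close> leaves room for adding some \<open>x\<close> in
  \<open>[0, 1]\<close> without exceeding \<open>b ^ k\<close>.\<close>

lemma partial_freq_bound:
  assumes "\<delta> \<in> W n"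
  shows "\<bar>partial_freq \<delta> k\<bar> \<le> b ^ k - 1"
proof (induction k)
  case (Suc k)
  have "\<bar>digit \<delta> k\<bar> \<le> b - 1"
    using digit_range[OF assms, of k] b_ge by auto
  then have "\<bar>digit \<delta> k * b ^ k\<bar> \<le> (b - 1) * b ^ k"
    using b_ge by (simp add: abs_mult mult_right_mono)
  with Suc show ?case by (simp add: partial_freq_def algebra_simps)
qed (simp add: partial_freq_def)

text \<open>Digits from index \<open>n\<close> on change the frequency by a multiple of
  \<open>b ^ n\<close>, which the first \<open>n\<close> masks do not see.\<close>

lemma power_spec_freq:
  assumes "\<delta> \<in> W n" "terminating \<delta>"
  shows "power_spec (x + freq \<delta>) =
    mask_prod n (x + of_int (partial_freq \<delta> n)) * power_spec ((x + freq \<delta>) / B ^ n)"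
proof -
  obtain m where "freq \<delta> = of_int (partial_freq \<delta> n + b ^ n * (1 * m))"
    using freq_tail[OF assms(2), of n 1] by auto
  then show ?thesis
    using power_spec_mask_prod[of "x + freq \<delta>" n] mask_prod_shift[of n "x + of_int (partial_freq \<delta> n)" m]
    by (simp add: add.assoc)
qed

section \<open>Weights of words and of their children\<close>

lemma sum_W_Suc:
  "(\<Sum>\<delta>\<in>W (Suc n). f \<delta>) = (\<Sum>\<delta>\<in>W n. \<Sum>i<nat q. f (\<delta> @ [int i]))"
proof -
  have "(\<Sum>\<delta>\<in>W n. \<Sum>i<nat q. f (\<delta> @ [int i])) =
      (\<Sum>(\<delta>, i)\<in>W n \<times> {..<nat q}. f (\<delta> @ [int i]))"
    by (rule sum.cartesian_product)
  also have "\<dots> = (\<Sum>\<delta>\<in>W (Suc n). f \<delta>)"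
    by (rule sum.reindex_bij_witness[of _ "\<lambda>\<delta>. (butlast \<delta>, nat (last \<delta>))" "\<lambda>(\<delta>, i). \<delta> @ [int i]"])
      (auto simp: words_of_length_def length_Suc_conv_rev dest: in_set_butlastD)
  finally show ?thesis ..
qed

lemma W_0: "W 0 = {[]}"
  by (auto simp: words_of_length_def)

lemma W_append: "\<delta> \<in> W n \<Longrightarrow> i < nat q \<Longrightarrow> \<delta> @ [int i] \<in> W (Suc n)"
  by (auto simp: words_of_length_def)

lemma digit_append: "\<delta> \<in> W n \<Longrightarrow> digit (\<delta> @ [i]) n = \<tau> (\<delta> @ [i])"
  by (simp add: digit_def words_of_length_def prefix_pad_def)

lemma partial_freq_append:
  assumes "\<delta> \<in> W n"
  shows "partial_freq (\<delta> @ [i]) (Suc n) = partial_freq \<delta> n + b ^ n * \<tau> (\<delta> @ [i])"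
proof -
  have "digit (\<delta> @ [i]) k = digit \<delta> k" if "k < n" for k
    unfolding digit_def using that by (subst prefix_pad_append[OF assms]) auto
  then show ?thesis
    by (simp add: partial_freq_def digit_append[OF assms])
qed

definition weight :: "real \<Rightarrow> nat \<Rightarrow> int list \<Rightarrow> real" where
  "weight x n \<delta> = mask_prod n (x + of_int (partial_freq \<delta> n))"

lemma weight_nonneg: "weight x n \<delta> \<ge> 0"
  by (simp add: weight_def mask_prod_nonneg)

text \<open>The new digit shifts by a multiple of \<open>b ^ n\<close>, so it enters only through
  the one additional mask.\<close>

lemma weight_append:
  assumes "\<delta> \<in> W n"
  shows "weight x (Suc n) (\<delta> @ [i]) =
    weight x n \<delta> * mask (nat q) ((x + of_int (partial_freq \<delta> n)) / B ^ n + of_int (\<tau> (\<delta> @ [i])))"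
proof -
  have "(x + of_int (partial_freq \<delta> n) + of_int (b ^ n * \<tau> (\<delta> @ [i]))) / B ^ n =
      (x + of_int (partial_freq \<delta> n)) / B ^ n + of_int (\<tau> (\<delta> @ [i]))"
    using b_ge by (simp add: add_divide_distrib)
  then show ?thesis
    using mask_prod_shift[of n "x + of_int (partial_freq \<delta> n)" "\<tau> (\<delta> @ [i])"]
    unfolding weight_def partial_freq_append[OF assms] of_int_add add.assoc[symmetric]
    by (simp add: mask_prod_def)
qed

text \<open>By condition (ii) the values of \<open>\<tau>\<close> at the children form a complete
  residue system modulo \<open>q\<close>, so the additional masks sum to 1.\<close>

lemma sum_weight_append:
  assumes "\<delta> \<in> W n"
  shows "(\<Sum>i<nat q. weight x (Suc n) (\<delta> @ [int i])) = weight x n \<delta>"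
proof -
  have "(\<Sum>i<nat q. mask (nat q) ((x + of_int (partial_freq \<delta> n)) / B ^ n +
      of_int (\<tau> (\<delta> @ [int i])))) = 1"
    using tree_last_digit[OF assms] q by (intro mask_sum) auto
  then show ?thesis
    by (simp add: weight_append[OF assms] flip: sum_distrib_left)
qed

lemma sum_weight: "(\<Sum>\<delta>\<in>W n. weight x n \<delta>) = 1"
proof (induction n)
  case (Suc n)
  then show ?case by (simp add: sum_W_Suc sum_weight_append)
qed (simp add: W_0 weight_def mask_prod_def)

text \<open>
  Every nonzero digit after level \<open>n\<close> is a multiple of \<open>q\<close> in \<open>{q..b - q}\<close>, so the argument of the
  corresponding factor stays at distance at least \<open>1 / b\<close> from the points where the mask is 1.
\<close>

lemma mask_nonzero_digit:
  assumes \<delta>: "\<delta> \<in> W n" "terminating \<delta>" and x: "x \<in> {0..1}"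
    and j: "n \<le> j" "digit \<delta> j \<noteq> 0"
  shows "\<exists>y\<in>{1 / B..1 - 1 / B}. mask (nat q) ((x + freq \<delta>) / B ^ Suc j) = mask (nat q) y"
proof -
  \<comment> \<open>All digits after \<open>j\<close> are multiples of \<open>q\<close>, so after
    division by \<open>B ^ Suc j\<close> they only shift by a multiple of the period.\<close>
  obtain m where m: "freq \<delta> = of_int (partial_freq \<delta> (Suc j) + b ^ Suc j * (q * m))"
    by (rule freq_tail[OF \<delta>(2), of "Suc j" q]) (use q_dvd_digit[OF \<delta>(1)] j in auto)
  \<comment> \<open>\<open>r\<close> collects \<open>x\<close> and the digits below
    \<open>j\<close>, of total size at most \<open>1 / B\<close>; \<open>y\<close> adds the digit
    \<open>j\<close> itself.\<close>
  define r where "r = (x + of_int (partial_freq \<delta> j)) / B ^ Suc j"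
  define y where "y = r + of_int (digit \<delta> j) / B"
  have B: "B \<ge> 4" using b_ge by simp
  have "(x + freq \<delta>) / B ^ Suc j = y + of_int (q * m)"
    unfolding m y_def r_def partial_freq_def using B by (simp add: field_simps)
  then have eq: "mask (nat q) ((x + freq \<delta>) / B ^ Suc j) = mask (nat q) y"
    by (simp only: mask_shift)
  have "real_of_int \<bar>partial_freq \<delta> j\<bar> \<le> real_of_int (b ^ j - 1)"
    using partial_freq_bound[OF \<delta>(1), of j] by (simp only: of_int_le_iff)
  then have "\<bar>real_of_int (partial_freq \<delta> j)\<bar> \<le> B ^ j - 1" by simp
  then have "\<bar>x + of_int (partial_freq \<delta> j)\<bar> \<le> B ^ j" using x by auto
  then have "\<bar>r\<bar> \<le> B ^ j / B ^ Suc j"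
    unfolding r_def abs_divide using B by (intro frac_le) simp_all
  also have "B ^ j / B ^ Suc j = 1 / B"
    using B by simp
  finally have r: "\<bar>r\<bar> \<le> 1 / B" .
  obtain e where e: "digit \<delta> j = q * e" using q_dvd_digit[OF \<delta>(1) j(1)] by (elim dvdE)
  obtain f where f: "b = q * f" using q_dvd_b by (elim dvdE)
  have "-1 \<le> q * e" "q * e \<noteq> 0" "q * e \<le> q * f - 2"
    using digit_range[OF \<delta>(1), of j] j(2) by (auto simp: e f)
  \<comment> \<open>A negative multiple of \<open>q\<close> is at most -2, below the digit
    range.\<close>
  have "1 \<le> e"
  proof (rule ccontr)
    assume "\<not> 1 \<le> e"
    moreover have "e \<noteq> 0" using \<open>q * e \<noteq> 0\<close> by auto
    ultimately have "q * e \<le> q * (- 1)"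
      using q by (intro mult_left_mono) auto
    with \<open>-1 \<le> q * e\<close> q show False by simp
  qed
  have "q * e < q * f" using \<open>q * e \<le> q * f - 2\<close> by simp
  then have "e \<le> f - 1" using q by simp
  have "q \<le> q * e" "q * e \<le> q * f - q"
    using q mult_left_mono[OF \<open>1 \<le> e\<close>, of q] mult_left_mono[OF \<open>e \<le> f - 1\<close>, of q]
    by (simp_all add: right_diff_distrib)
  then have "2 \<le> digit \<delta> j" "digit \<delta> j \<le> b - 2"
    using q e f by linarith+
  then have "2 \<le> real_of_int (digit \<delta> j)" "real_of_int (digit \<delta> j) \<le> B - 2"
    by linarith+
  then have "2 / B \<le> of_int (digit \<delta> j) / B" "of_int (digit \<delta> j) / B \<le> (B - 2) / B"
    using B divide_right_mono[of _ _ B] by simp_all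
  \<comment> \<open>The digit keeps a distance \<open>2 / B\<close> from both ends, of which
    \<open>r\<close> uses up at most \<open>1 / B\<close>.\<close>
  moreover have "(B - 2) / B = 1 - 2 * (1 / B)" "2 / B = 2 * (1 / B)"
    using B by (simp_all add: field_simps)
  ultimately have "y \<in> {1 / B..1 - 1 / B}"
    using r unfolding y_def atLeastAtMost_iff abs_le_iff by linarith
  with eq show ?thesis by blast
qed

section \<open>The deficit of the spectral mass\<close>

lemma prefix_pad_zero: "prefix_pad [0] m = replicate m 0"
  by (cases m) (simp_all add: prefix_pad_def take_Cons' flip: replicate_Suc)

text \<open>Words being nonempty, \<open>[0]\<close> represents the continuation by zeros; its
  \<open>m\<close>-th letter has digit index \<open>n + m - 1\<close>.\<close>

lemma level_A_zero:
  assumes "\<delta> \<in> W n"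
  shows "level_A \<tau> \<delta> [0] = {m. m \<ge> 1 \<and> digit \<delta> (n + m - 1) \<noteq> 0}"
  unfolding level_A_def prefix_pad_zero digit_def
  by (auto simp flip: prefix_pad_append_zeros[OF assms])

lemma level_A_zero_subset:
  assumes "\<delta> \<in> W n" "terminating \<delta>"
  obtains K where "level_A \<tau> \<delta> [0] \<subseteq> {..<K}"
proof -
  obtain K where K: "\<And>k. k \<ge> K \<Longrightarrow> digit \<delta> k = 0"
    using assms(2) unfolding terminating_def eventually_sequentially by blast
  have "m < Suc K" if "m \<in> level_A \<tau> \<delta> [0]" for m
  proof (rule ccontr)
    assume "\<not> m < Suc K"
    then have "digit \<delta> (n + m - 1) = 0" by (intro K) linarith
    then show False
      using that by (simp add: level_A_zero[OF assms(1)])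
  qed
  then show thesis by (intro that[of "Suc K"]) auto
qed

text \<open>Testing the infimum at \<open>[0]\<close>: all values past \<open>\<delta>\<close> are
  multiples of \<open>q\<close>, so \<open>level_B\<close> is empty and the gap terms drop
  out.\<close>

lemma min_level_diff_le:
  assumes "\<delta> \<in> W n" "terminating \<delta>"
  shows "min_level_diff q \<tau> \<delta> \<le> enat (card (level_A \<tau> \<delta> [0]))"
proof -
  obtain K where "level_A \<tau> \<delta> [0] \<subseteq> {..<K}"
    by (rule level_A_zero_subset[OF assms])
  then have fin: "finite (level_A \<tau> \<delta> [0])"
    by (rule finite_subset) simp
  have "m \<notin> level_B q \<tau> \<delta> [0]" for m
    using q_dvd_tree_zeros[OF assms(1), of m] by (auto simp: level_B_def prefix_pad_zero dvd_def)
  then have "level_diff q \<tau> \<delta> [0] = enat (card (level_A \<tau> \<delta> [0]))"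
    using fin by (simp add: level_diff_def Let_def)
  moreover have "[0] \<in> words q"
    using q by (auto simp: words_def words_of_length_def)
  ultimately show ?thesis
    unfolding min_level_diff_def by (metis INF_lower)
qed

text \<open>Each nonzero digit past level \<open>n\<close> makes one mask at most \<open>c\<close>;
  all other factors are bounded by 1.\<close>

lemma power_spec_decay:
  assumes \<delta>: "\<delta> \<in> W n" "terminating \<delta>" and x: "x \<in> {0..1}"
    and c: "\<And>y. y \<in> {1 / B..1 - 1 / B} \<Longrightarrow> mask (nat q) y \<le> c"
  shows "power_spec ((x + freq \<delta>) / B ^ n) \<le> c ^ card (level_A \<tau> \<delta> [0])"
proof -
  obtain K where K: "level_A \<tau> \<delta> [0] \<subseteq> {..<K}"
    by (rule level_A_zero_subset[OF \<delta>])
  have le: "mask (nat q) ((x + freq \<delta>) / B ^ n / B ^ j) \<le> (if j \<in> level_A \<tau> \<delta> [0] then c else 1)" for j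
  proof (cases "j \<in> level_A \<tau> \<delta> [0]")
    case True
    then have j: "j \<ge> 1" "digit \<delta> (n + j - 1) \<noteq> 0"
      by (auto simp: level_A_zero[OF \<delta>(1)])
    \<comment> \<open>Factor \<open>j\<close> has denominator \<open>B ^ (n + j)\<close> and is
      governed by the digit of index \<open>n + j - 1\<close>, which is exactly the indexing of
      \<open>level_A\<close>.\<close>
    then have "B ^ Suc (n + j - 1) = B ^ n * B ^ j"
      by (subst power_add[symmetric]) simp
    moreover have "n \<le> n + j - 1" using j(1) by simp
    from mask_nonzero_digit[OF \<delta> x this j(2)]
    have "mask (nat q) ((x + freq \<delta>) / B ^ Suc (n + j - 1)) \<le> c"
      using c by fastforce
    ultimately show ?thesis using True by simp
  qed (simp add: mask_le_1)
  have "power_spec ((x + freq \<delta>) / B ^ n) \<le> mask_prod K ((x + freq \<delta>) / B ^ n)"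
    using mult_left_mono[OF power_spec_le_1 mask_prod_nonneg]
    by (subst power_spec_mask_prod[of _ K]) simp
  also have "\<dots> \<le> (\<Prod>j<K. if j \<in> level_A \<tau> \<delta> [0] then c else 1)"
    unfolding mask_prod_def using le by (intro prod_mono) simp
  also have "\<dots> = c ^ card (level_A \<tau> \<delta> [0])"
    using K by (simp add: prod.If_cases Int_absorb1)
  finally show ?thesis .
qed

section \<open>The spectral mass from one level to the next\<close>

text \<open>The value 0 lets words without a frequency keep their weight while contributing no
  mass.\<close>

definition tail_spec :: "real \<Rightarrow> nat \<Rightarrow> int list \<Rightarrow> real" where
  "tail_spec x n \<delta> = (if terminating \<delta> then power_spec ((x + freq \<delta>) / B ^ n) else 0)"

definition level_spec :: "real \<Rightarrow> nat \<Rightarrow> real" where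
  "level_spec x n = (\<Sum>\<delta>\<in>W n. if terminating \<delta> then power_spec (x + freq \<delta>) else 0)"

lemma level_spec_eq: "level_spec x n = (\<Sum>\<delta>\<in>W n. weight x n \<delta> * tail_spec x n \<delta>)"
  unfolding level_spec_def by (intro sum.cong refl) (simp add: tail_spec_def weight_def power_spec_freq)

lemma digit_append_zero: "digit (\<delta> @ [0]) k = digit \<delta> k"
  using prefix_pad_append_zero[of \<delta> 1] by (simp add: digit_def)

lemma terminating_append_zero: "terminating (\<delta> @ [0]) \<longleftrightarrow> terminating \<delta>"
  by (simp add: terminating_def digit_append_zero)

lemma freq_append_zero: "freq (\<delta> @ [0]) = freq \<delta>"
  by (simp add: freq_def digit_append_zero)

text \<open>Only the first mask of the remaining factor is kept. Later digits shift its argument by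
  multiples of \<open>b\<close>, so it is the share of the weight of \<open>\<delta>\<close> that
  passes to the child \<open>\<delta> @ [0]\<close>.\<close>

lemma tail_spec_le_mask:
  assumes "\<delta> \<in> W n"
  shows "tail_spec x n \<delta> \<le>
    mask (nat q) ((x + of_int (partial_freq \<delta> n)) / B ^ n + of_int (\<tau> (\<delta> @ [0])))"
proof (cases "terminating \<delta>")
  case True
  obtain m where "freq \<delta> = of_int (partial_freq \<delta> (Suc n) + b ^ Suc n * (1 * m))"
    by (rule freq_tail[OF True, of "Suc n" 1]) auto
  then have "freq \<delta> = of_int (partial_freq \<delta> n) + of_int (\<tau> (\<delta> @ [0])) * B ^ n + of_int (b * m) * B ^ n"
    using digit_append[OF assms, of 0] by (simp add: partial_freq_def digit_append_zero)
  then have "(x + freq \<delta>) / B ^ n =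
      (x + of_int (partial_freq \<delta> n)) / B ^ n + of_int (\<tau> (\<delta> @ [0])) + of_int (b * m)"
    using b_ge by (simp add: add_divide_distrib)
  then have "mask (nat q) ((x + freq \<delta>) / B ^ n) =
      mask (nat q) ((x + of_int (partial_freq \<delta> n)) / B ^ n + of_int (\<tau> (\<delta> @ [0])))"
    using q_dvd_b by (simp only: mask_shift_dvd dvd_mult2)
  then show ?thesis
    using True power_spec_le_mask[of "(x + freq \<delta>) / B ^ n"] by (simp add: tail_spec_def)
qed (simp add: tail_spec_def)

lemma level_spec_step:
  assumes bound: "\<And>\<delta>. \<delta> \<in> W (Suc n) \<Longrightarrow> \<delta> ! n \<noteq> 0 \<Longrightarrow> tail_spec x (Suc n) \<delta> \<le> r"
    and r: "0 \<le> r"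
  shows "(1 - r) * (1 - level_spec x n) \<le> 1 - level_spec x (Suc n)"
proof -
  have "level_spec x (Suc n) =
      (\<Sum>\<delta>\<in>W n. \<Sum>i<nat q. if terminating (\<delta> @ [int i]) then power_spec (x + freq (\<delta> @ [int i])) else 0)"
    unfolding level_spec_def by (rule sum_W_Suc)
  also have "\<dots> \<le> (\<Sum>\<delta>\<in>W n. weight x n \<delta> * tail_spec x n \<delta> + r * (weight x n \<delta> * (1 - tail_spec x n \<delta>)))"
  proof (rule sum_mono)
    fix \<delta> assume \<delta>: "\<delta> \<in> W n"
    \<comment> \<open>\<open>f i\<close> is the spectral mass of the \<open>i\<close>-th child and
      \<open>g i\<close> its weight.\<close>
    define f where "f i = (if terminating (\<delta> @ [int i]) then power_spec (x + freq (\<delta> @ [int i])) else 0)" for i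
    define g where "g i = weight x (Suc n) (\<delta> @ [int i])" for i
    obtain p where p: "nat q = Suc p"
      using q by (metis Suc_pred' zero_less_nat_eq less_le_trans zero_less_numeral)
    have f0: "f 0 = weight x n \<delta> * tail_spec x n \<delta>"
      using \<delta> by (simp add: f_def terminating_append_zero freq_append_zero tail_spec_def
        weight_def power_spec_freq)
    have fi: "f (Suc i) \<le> r * g (Suc i)" if "i < p" for i
    proof -
      have W: "\<delta> @ [int (Suc i)] \<in> W (Suc n)"
        using that p by (intro W_append[OF \<delta>]) simp
      have "(\<delta> @ [int (Suc i)]) ! n \<noteq> 0"
        using \<delta> by (simp add: words_of_length_def nth_append)
      then have "tail_spec x (Suc n) (\<delta> @ [int (Suc i)]) \<le> r"
        by (rule bound[OF W])
      moreover have "f (Suc i) = g (Suc i) * tail_spec x (Suc n) (\<delta> @ [int (Suc i)])"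
        using power_spec_freq[OF W, of x] unfolding f_def g_def tail_spec_def weight_def by simp
      ultimately show ?thesis
        by (metis g_def mult.commute mult_left_mono weight_nonneg)
    qed
    \<comment> \<open>The 0-child takes at least the mass of its parent out of the weight, which
      limits the weight left to the other children.\<close>
    have "g 0 \<ge> weight x n \<delta> * tail_spec x n \<delta>"
      unfolding g_def weight_append[OF \<delta>]
      using tail_spec_le_mask[OF \<delta>] by (intro mult_left_mono weight_nonneg) simp
    moreover have "g 0 + (\<Sum>i<p. g (Suc i)) = weight x n \<delta>"
      using sum_weight_append[OF \<delta>, of x] unfolding p sum.lessThan_Suc_shift g_def .
    ultimately have "(\<Sum>i<p. g (Suc i)) \<le> weight x n \<delta> * (1 - tail_spec x n \<delta>)"
      by (simp add: right_diff_distrib)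
    then have "r * (\<Sum>i<p. g (Suc i)) \<le> r * (weight x n \<delta> * (1 - tail_spec x n \<delta>))"
      using r by (rule mult_left_mono)
    moreover have "(\<Sum>i<p. f (Suc i)) \<le> r * (\<Sum>i<p. g (Suc i))"
      unfolding sum_distrib_left using fi by (intro sum_mono) simp
    ultimately have "(\<Sum>i<nat q. f i) \<le>
        weight x n \<delta> * tail_spec x n \<delta> + r * (weight x n \<delta> * (1 - tail_spec x n \<delta>))"
      unfolding p sum.lessThan_Suc_shift f0 by linarith
    then show "(\<Sum>i<nat q. if terminating (\<delta> @ [int i]) then power_spec (x + freq (\<delta> @ [int i])) else 0) \<le>
        weight x n \<delta> * tail_spec x n \<delta> + r * (weight x n \<delta> * (1 - tail_spec x n \<delta>))"
      unfolding f_def .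
  qed
  also have "\<dots> = level_spec x n + r * (\<Sum>\<delta>\<in>W n. weight x n \<delta> * (1 - tail_spec x n \<delta>))"
    by (simp add: sum.distrib level_spec_eq sum_distrib_left)
  also have "(\<Sum>\<delta>\<in>W n. weight x n \<delta> * (1 - tail_spec x n \<delta>)) = 1 - level_spec x n"
    by (simp add: right_diff_distrib sum_subtractf sum_weight level_spec_eq)
  finally show ?thesis by (simp add: algebra_simps)
qed

lemma level_spec_bounded:
  assumes x: "x \<in> {1 / B..1 - 1 / B}" and \<epsilon>: "\<epsilon> > 0"
    and level: "\<And>n \<delta>. \<delta> \<in> W (Suc n) \<Longrightarrow> \<delta> ! n \<noteq> 0 \<Longrightarrow>
      ereal (\<epsilon> * real (Suc n)) \<le> ereal_of_enat (min_level_diff q \<tau> \<delta>)"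
  shows "\<exists>\<kappa>>0. \<forall>n. level_spec x n \<le> 1 - \<kappa>"
proof -
  have B: "1 / B > 0" using b_ge by simp
  then have x01: "x \<in> {0..1}" using x by (auto simp del: zero_less_divide_1_iff)
  obtain c where c: "0 < c" "c < 1" "\<And>y. y \<in> {1 / B..1 - 1 / B} \<Longrightarrow> mask (nat q) y \<le> c"
  proof -
    have "2 \<le> nat q" using q by simp
    from mask_gap[OF this B] show thesis using that by blast
  qed
  \<comment> \<open>Turns a number of factors \<open>c\<close> that grows linearly with the level
    into a geometric rate.\<close>
  define \<rho> where "\<rho> = c powr \<epsilon>"
  have \<rho>: "0 < \<rho>" "\<rho> < 1"
    using c \<epsilon> powr_less_mono'[of c 0 \<epsilon>] by (auto simp: \<rho>_def)
  have tail: "tail_spec x (Suc n) \<delta> \<le> \<rho> ^ Suc n" if \<delta>: "\<delta> \<in> W (Suc n)" "\<delta> ! n \<noteq> 0" for n \<delta>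
  proof (cases "terminating \<delta>")
    case True
    let ?a = "card (level_A \<tau> \<delta> [0])"
    have "ereal (\<epsilon> * real (Suc n)) \<le> ereal_of_enat (enat ?a)"
      using level[OF \<delta>] min_level_diff_le[OF \<delta>(1) True]
      by (meson ereal_of_enat_le_iff order_trans)
    then have a: "\<epsilon> * real (Suc n) \<le> real ?a" by simp
    have "tail_spec x (Suc n) \<delta> \<le> c ^ ?a"
      using power_spec_decay[OF \<delta>(1) True x01 c(3)] True by (simp add: tail_spec_def)
    also have "\<dots> = c powr real ?a"
      using c by (simp add: powr_realpow)
    also have "\<dots> \<le> c powr (\<epsilon> * real (Suc n))"
      using c a by (intro powr_mono') auto
    also have "\<dots> = \<rho> ^ Suc n"
      unfolding \<rho>_def powr_powr[symmetric] using c by (intro powr_realpow) simp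
    finally show ?thesis .
  qed (use \<rho> in \<open>simp add: tail_spec_def\<close>)
  \<comment> \<open>Level 0 consists of the empty word, whose frequency is 0 by condition (i); hence
    the mass there is \<open>power_spec x\<close>, and the deficit starts out positive.\<close>
  have "power_spec x < 1"
    using power_spec_le_mask[of x] c(2) c(3)[OF x] by linarith
  moreover have "freq [] = 0" "terminating []"
  proof -
    have "digit [] k = 0" for k
      using tree by (simp add: digit_def prefix_pad_def tree_mapping_def del: replicate_Suc)
    then show "freq [] = 0" "terminating []"
      by (simp_all add: freq_def terminating_def)
  qed
  ultimately have start: "level_spec x 0 < 1"
    by (simp add: level_spec_def W_0)
  have prod: "(\<Prod>k<n. 1 - \<rho> ^ Suc k) * (1 - level_spec x 0) \<le> 1 - level_spec x n" for n
  proof (induction n)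
    case (Suc n)
    have "\<rho> ^ Suc n \<le> 1" using \<rho> by (intro power_le_one) auto
    then have "(1 - \<rho> ^ Suc n) * ((\<Prod>k<n. 1 - \<rho> ^ Suc k) * (1 - level_spec x 0)) \<le>
        (1 - \<rho> ^ Suc n) * (1 - level_spec x n)"
      using Suc.IH by (intro mult_left_mono) simp_all
    also have "\<dots> \<le> 1 - level_spec x (Suc n)"
      using tail \<rho> by (intro level_spec_step) auto
    finally show ?case by (simp add: mult_ac)
  qed simp
  obtain \<kappa> where \<kappa>: "\<kappa> > 0" "\<And>n. \<kappa> \<le> (\<Prod>k<n. 1 - \<rho> ^ Suc k)"
    using geometric_product_bounded_below[OF \<rho>] by auto
  have "level_spec x n \<le> 1 - \<kappa> * (1 - level_spec x 0)" for n
    using prod[of n] mult_right_mono[OF \<kappa>(2)[of n], of "1 - level_spec x 0"] start by linarith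
  then show ?thesis
    using \<kappa>(1) start by (intro exI[of _ "\<kappa> * (1 - level_spec x 0)"]) simp
qed

section \<open>From the levels to the whole spectrum\<close>

lemma finite_W: "finite (W n)"
  unfolding words_of_length_def by (rule finite_subset[OF _ finite_lists_length_eq[of "{0..q - 1}" n]]) auto

lemma digit_pad:
  "digit (\<delta> @ replicate m 0) = digit \<delta>"
  by (simp add: fun_eq_iff digit_def prefix_pad_append_zero)

text \<open>Appending zeros does not change a frequency, so finitely many words can be brought to a
  common length.\<close>

lemma finite_tree_spectrum_level:
  assumes "finite F" "F \<subseteq> tree_spectrum q b \<tau>"
  obtains n where "F \<subseteq> freq ` {\<delta>\<in>W n. terminating \<delta>}"
proof -
  have "\<exists>\<delta>. \<delta> \<in> words q \<and> terminating \<delta> \<and> freq \<delta> = z" if "z \<in> F" for z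
    using that assms(2) unfolding tree_spectrum_def terminating_def freq_def digit_def
    by (auto simp: eventually_sequentially_Suc[of "\<lambda>m. \<tau> (prefix_pad _ m) = 0"])
  then obtain w where w: "\<And>z. z \<in> F \<Longrightarrow> w z \<in> words q \<and> terminating (w z) \<and> freq (w z) = z"
    by metis
  define n where "n = Max (length ` w ` F)"
  have "z \<in> freq ` {\<delta>\<in>W n. terminating \<delta>}" if z: "z \<in> F" for z
  proof
    let ?d = "w z @ replicate (n - length (w z)) 0"
    have "length (w z) \<le> n"
      unfolding n_def using assms(1) z by (intro Max_ge) auto
    then show "?d \<in> {\<delta>\<in>W n. terminating \<delta>}"
      using w[OF z] q by (auto simp: words_def words_of_length_def terminating_def digit_pad)
    show "z = freq ?d"
      using w[OF z] by (simp add: freq_def digit_pad)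
  qed
  then show thesis by (intro that) blast
qed

text \<open>Words sharing a frequency count once on the left and separately on the right, and all
  terms are nonnegative.\<close>

lemma sum_power_spec_le_level_spec:
  assumes "finite F" "F \<subseteq> freq ` {\<delta>\<in>W n. terminating \<delta>}"
  shows "(\<Sum>z\<in>F. power_spec (x + z)) \<le> level_spec x n"
proof -
  have "(\<Sum>z\<in>F. power_spec (x + z)) \<le> (\<Sum>z\<in>freq ` {\<delta>\<in>W n. terminating \<delta>}. power_spec (x + z))"
    using assms finite_W by (intro sum_mono2) (auto simp: power_spec_nonneg)
  also have "\<dots> \<le> (\<Sum>\<delta> | \<delta> \<in> W n \<and> terminating \<delta>. power_spec (x + freq \<delta>))"
    using finite_W sum_image_le[of "{\<delta>\<in>W n. terminating \<delta>}" "\<lambda>z. power_spec (x + z)" freq]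
    by (simp add: power_spec_nonneg o_def)
  also have "\<dots> = level_spec x n"
    unfolding level_spec_def using finite_W by (simp add: sum.inter_filter)
  finally show ?thesis .
qed

lemma not_spectrum:
  assumes \<epsilon>: "\<epsilon> > 0"
    and level: "\<And>n \<delta>. \<delta> \<in> W (Suc n) \<Longrightarrow> \<delta> ! n \<noteq> 0 \<Longrightarrow>
      ereal (\<epsilon> * real (Suc n)) \<le> ereal_of_enat (min_level_diff q \<tau> \<delta>)"
  shows "\<not> is_spectrum (cantor_measure q b) (tree_spectrum q b \<tau>)"
proof
  let ?\<mu> = "cantor_measure q b" and ?\<Lambda> = "tree_spectrum q b \<tau>"
  assume spec: "is_spectrum ?\<mu> ?\<Lambda>"
  have "1 / B \<le> 1 / 2" using b_ge by (intro divide_left_mono) auto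
  then have "1 / 2 \<in> {1 / B..1 - 1 / B}" by simp
  from level_spec_bounded[OF this \<epsilon> level]
  obtain \<kappa> where \<kappa>: "\<kappa> > 0" "\<And>n. level_spec (1 / 2) n \<le> 1 - \<kappa>" by blast
  have dense: "\<forall>\<epsilon>>0. \<exists>F c. finite F \<and> F \<subseteq> ?\<Lambda> \<and>
      sqrt (\<integral>x. (cmod (exponential (- 1 / 2) x - (\<Sum>\<xi>\<in>F. c \<xi> * exponential \<xi> x)))\<^sup>2 \<partial>?\<mu>) < \<epsilon>"
    using spec square_integrable_exponential[OF real_distribution_cantor]
    unfolding is_spectrum_def by blast
  \<comment> \<open>The tolerance matches the deficit: Bessel's inequality keeps the squared error
    at or above \<open>\<kappa>\<close> for every finite \<open>F\<close>.\<close>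
  have "sqrt \<kappa> > 0" using \<kappa>(1) by simp
  with dense obtain F c where F: "finite F" "F \<subseteq> ?\<Lambda>" and
    "sqrt (\<integral>x. (cmod (exponential (- 1 / 2) x - (\<Sum>\<xi>\<in>F. c \<xi> * exponential \<xi> x)))\<^sup>2 \<partial>?\<mu>) < sqrt \<kappa>"
    by blast
  then have approx:
    "(\<integral>x. (cmod (exponential (- 1 / 2) x - (\<Sum>\<xi>\<in>F. c \<xi> * exponential \<xi> x)))\<^sup>2 \<partial>?\<mu>) < \<kappa>"
    by (simp only: real_sqrt_less_iff)
  obtain n where n: "F \<subseteq> freq ` {\<delta>\<in>W n. terminating \<delta>}"
    by (rule finite_tree_spectrum_level[OF F])
  have orth: "(\<integral>x. exponential z x * cnj (exponential w x) \<partial>?\<mu>) = 0"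
    if "z \<in> F" "w \<in> F" "z \<noteq> w" for z w
    using spec that F(2) unfolding is_spectrum_def by blast
  have "1 - (\<Sum>z\<in>F. power_spec (1 / 2 + z)) < \<kappa>"
    using exponential_approximation_bound[OF real_distribution_cantor F(1) orth, of "- 1 / 2" c] approx
    by (simp add: power_spec_def add.commute)
  with sum_power_spec_le_level_spec[OF F(1) n, of "1 / 2"] \<kappa>(2)[of n]
  show False by linarith
qed

end

theorem theorem2p5:
  fixes q b :: int and \<tau> :: "int list \<Rightarrow> int"
  assumes "q \<ge> 2" and "q dvd b" and "b div q \<ge> 2"
    and "maximal_tree_mapping q b \<tau>"
    and "\<exists>\<epsilon>\<^sub>0::real. \<epsilon>\<^sub>0 > 0 \<and>
           (\<forall>n\<ge>1. \<forall>\<delta>\<in>words_of_length q n. \<delta> ! (n - 1) \<noteq> 0 \<longrightarrow>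
              ereal_of_enat (min_level_diff q \<tau> \<delta>) \<ge> ereal (\<epsilon>\<^sub>0 * real n))"
  shows "\<not> is_spectrum (cantor_measure q b) (tree_spectrum q b \<tau>)"
proof -
  interpret cantor_tree q b \<tau>
    using assms by unfold_locales (auto simp: maximal_tree_mapping_def)
  obtain \<epsilon>\<^sub>0 :: real where "\<epsilon>\<^sub>0 > 0" and
    level: "\<And>n \<delta>. n \<ge> 1 \<Longrightarrow> \<delta> \<in> words_of_length q n \<Longrightarrow> \<delta> ! (n - 1) \<noteq> 0 \<Longrightarrow>
      ereal_of_enat (min_level_diff q \<tau> \<delta>) \<ge> ereal (\<epsilon>\<^sub>0 * real n)"
    using assms(5) by blast
  have "ereal (\<epsilon>\<^sub>0 * real (Suc n)) \<le> ereal_of_enat (min_level_diff q \<tau> \<delta>)"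
    if "\<delta> \<in> words_of_length q (Suc n)" "\<delta> ! n \<noteq> 0" for n \<delta>
    using level[of "Suc n" \<delta>] that by simp
  with \<open>\<epsilon>\<^sub>0 > 0\<close> show ?thesis
    by (rule not_spectrum)
qed

end
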